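(* Let $n$ be an odd natural number and $h_n:=\frac{n-1}{2}$. For $1\le\ell\le h_n$, $m\in\mathbb{N}_0$ and $x\in\mathbb{R}^{n+1}\setminus\{0\}$ one has $$\mathcal{H}_\ell^{2m+2\ell-1}(x)=\frac{(-1)^m\sqrt{\pi}\,\Gamma(m+\ell)\,|x|^{2m}}{\Gamma(\ell)\,\Gamma\left(m+\frac12\right)}\,P_m^{\left(-\frac12,\frac{2\ell-1}{2}\right)}\left(1-\frac{2x_0^2}{|x|^2}\right)$$ and $$\mathcal{H}_\ell^{2m+2\ell}(x)=\frac{(-1)^m\sqrt{\pi}\,\Gamma(m+\ell+1)\,x_0|x|^{2m}}{\Gamma(\ell)\,\Gamma\left(m+\frac32\right)}\,P_m^{\left(\frac12,\frac{2\ell-1}{2}\right)}\left(1-\frac{2x_0^2}{|x|^2}\right).$$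
   Context: $\mathbb{R}_n$ is the real Clifford algebra generated by $e_1,\dots,e_n$ with $e_ie_j+e_je_i=-2\delta_{ij}$. Elements of $\mathbb{R}^{n+1}$ are identified with paravectors $x=x_0+\sum_{j=1}^n x_je_j\in\mathbb{R}_n$; $\bar x=x_0-\sum_{j=1}^n x_je_j$, $|x|^2=\sum_{j=0}^n x_j^2$. For $\ell\ge1$ and $k\ge 2\ell-1$, $$\mathcal{H}_\ell^k(x):=\sum_{j=0}^{k-2\ell+1}\binom{\ell+j-1}{\ell-1}\binom{k-\ell-j}{\ell-1}x^{k-2\ell+1-j}\bar x^{\,j}.$$ The Jacobi polynomials are, for $\alpha,\beta>-1$ and $N\in\mathbb{N}_0$, $$P_N^{(\alpha,\beta)}(z)=\frac{\Gamma(\alpha+N+1)}{N!\,\Gamma(N+\alpha+\beta+1)}\sum_{\nu=0}^{N}\binom{N}{\nu}\frac{\Gamma(N+\alpha+\beta+\nu+1)}{\Gamma(\alpha+\nu+1)}\left(\frac{z-1}{2}\right)^\nu.$$ *)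

theory Defs
  imports "HOL-Analysis.Analysis"
begin

text \<open>
  The real Clifford algebra generated by \<open>e\<^sub>i\<close> (\<open>i :: 'n\<close>, so that \<open>n = CARD('n)\<close>) with
  \<open>e\<^sub>i e\<^sub>j + e\<^sub>j e\<^sub>i = - 2 \<delta>\<^sub>i\<^sub>j\<close>, given by coordinates with respect to its standard basis
  \<open>e\<^sub>A = e\<^sub>a\<^sub>1 \<dots> e\<^sub>a\<^sub>k\<close>, where \<open>A = {a\<^sub>1 < \<dots> < a\<^sub>k}\<close> runs over all sets of indices. In particular the
  dimension is \<open>2\<^sup>n\<close>. The linear order on \<open>'n\<close> only serves to fix this basis.
\<close>

typedef 'n clifford = "UNIV :: ('n set \<Rightarrow> real) set"
  morphisms cl_coeff Abs_clifford ..

setup_lifting type_definition_clifford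

lemma clifford_eqI: "(\<And>A. cl_coeff x A = cl_coeff y A) \<Longrightarrow> x = y"
  by (metis cl_coeff_inject ext)

text \<open>
  \<open>e\<^sub>A e\<^sub>B\<close> is \<open>blade_sign A B\<close> times the basis element of the symmetric difference: sorting the
  concatenated product costs a factor \<open>-1\<close> for each pair with \<open>b < a\<close> (anticommutation), and
  each \<open>a = b\<close> contributes \<open>e\<^sub>a\<^sup>2 = -1\<close>.
\<close>

definition blade_sign :: "'n::linorder set \<Rightarrow> 'n set \<Rightarrow> real" where
  "blade_sign A B = (-1) ^ card {(a, b). a \<in> A \<and> b \<in> B \<and> b \<le> a}"

lemma blade_sign_prod:
  fixes A B :: "'n::{finite,linorder} set"
  shows "blade_sign A B = (\<Prod>a\<in>A. \<Prod>b\<in>B. if b \<le> a then -1 else 1)"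
proof -
  have "(\<Prod>a\<in>A. \<Prod>b\<in>B. if b \<le> a then -1 else (1::real))
      = (\<Prod>p\<in>A \<times> B. if snd p \<le> fst p then -1 else 1)"
    by (simp add: prod.cartesian_product case_prod_beta)
  also have "\<dots> = (\<Prod>p\<in>{p \<in> A \<times> B. snd p \<le> fst p}. -1)"
    by (rule prod.inter_filter[symmetric]) simp
  also have "{p \<in> A \<times> B. snd p \<le> fst p} = {(a, b). a \<in> A \<and> b \<in> B \<and> b \<le> a}"
    by auto
  finally show ?thesis
    by (simp add: blade_sign_def)
qed

lemma prod_sym_diff:
  fixes f :: "'b \<Rightarrow> real"
  assumes "finite A" "finite B" "\<And>x. f x * f x = 1"
  shows "prod f (sym_diff A B) = prod f A * prod f B"
proof -
  have A: "prod f A = prod f (A - B) * prod f (A \<inter> B)"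
    using prod.Int_Diff[of A f B] assms by (simp add: mult.commute)
  have B: "prod f B = prod f (B - A) * prod f (A \<inter> B)"
    using prod.Int_Diff[of B f A] assms by (simp add: mult.commute Int_commute)
  have "prod f (A \<inter> B) * prod f (A \<inter> B) = 1"
    by (simp add: prod.distrib[symmetric] assms)
  moreover have "prod f (sym_diff A B) = prod f (A - B) * prod f (B - A)"
    by (rule prod.union_disjoint) (use assms in auto)
  ultimately show ?thesis
    unfolding A B by (simp add: algebra_simps)
qed

lemma blade_sign_square:
  fixes A B :: "'n::{finite,linorder} set"
  shows "blade_sign A B * blade_sign A B = 1"
  by (simp add: blade_sign_def flip: power_mult_distrib)

lemma blade_sign_sym_diff_left:
  fixes A B C :: "'n::{finite,linorder} set"
  shows "blade_sign (sym_diff A B) C = blade_sign A C * blade_sign B C"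
  unfolding blade_sign_prod
  by (rule prod_sym_diff) (auto simp: prod.distrib[symmetric] intro!: prod.neutral)

lemma blade_sign_sym_diff_right:
  fixes A B C :: "'n::{finite,linorder} set"
  shows "blade_sign A (sym_diff B C) = blade_sign A B * blade_sign A C"
proof -
  have "blade_sign A X = (\<Prod>b\<in>X. \<Prod>a\<in>A. if b \<le> a then -1 else 1)" for X
    unfolding blade_sign_prod by (rule prod.swap)
  then show ?thesis
    by (simp only:)
      (rule prod_sym_diff; auto simp: prod.distrib[symmetric] intro!: prod.neutral)
qed

lemma blade_sign_empty [simp]: "blade_sign {} A = 1" "blade_sign A {} = 1"
  by (simp_all add: blade_sign_def)

lemma sum_sym_diff_shift:
  fixes f :: "'n::finite set \<Rightarrow> real"
  shows "(\<Sum>A\<in>UNIV. f (sym_diff B A)) = (\<Sum>A\<in>UNIV. f A)"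
  by (rule sum.reindex_bij_witness[where i = "sym_diff B" and j = "sym_diff B"])
    (auto intro!: arg_cong[of _ _ f])

instantiation clifford :: ("{finite,linorder}") real_algebra_1
begin

lift_definition zero_clifford :: "'a clifford" is "\<lambda>_. 0" .
lift_definition one_clifford :: "'a clifford" is "\<lambda>A. if A = {} then 1 else 0" .
lift_definition plus_clifford :: "'a clifford \<Rightarrow> 'a clifford \<Rightarrow> 'a clifford"
  is "\<lambda>x y A. x A + y A" .
lift_definition minus_clifford :: "'a clifford \<Rightarrow> 'a clifford \<Rightarrow> 'a clifford"
  is "\<lambda>x y A. x A - y A" .
lift_definition uminus_clifford :: "'a clifford \<Rightarrow> 'a clifford"
  is "\<lambda>x A. - x A" .
lift_definition scaleR_clifford :: "real \<Rightarrow> 'a clifford \<Rightarrow> 'a clifford"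
  is "\<lambda>r x A. r * x A" .

text \<open>The bilinear extension of the product of basis elements; see \<open>blade_mult\<close> below.\<close>

lift_definition times_clifford :: "'a clifford \<Rightarrow> 'a clifford \<Rightarrow> 'a clifford"
  is "\<lambda>x y C. \<Sum>A\<in>UNIV. blade_sign A (sym_diff A C) * x A * y (sym_diff A C)" .

instance
proof
  fix x y z :: "'a clifford" and r s :: real
  show "x * y * z = x * (y * z)"
  proof (rule clifford_eqI)
    fix C :: "'a set"
    have sign: "blade_sign A (sym_diff A C) * blade_sign B (sym_diff B A)
        = blade_sign B (sym_diff B C) * blade_sign (sym_diff B A) (sym_diff A C)" for A B
    proof -
      have "sym_diff B (sym_diff B A) = A" "sym_diff (sym_diff B A) (sym_diff A C) = sym_diff B C"
        by auto
      then have "blade_sign A (sym_diff A C)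
          = blade_sign B (sym_diff A C) * blade_sign (sym_diff B A) (sym_diff A C)"
        and "blade_sign B (sym_diff B C)
          = blade_sign B (sym_diff B A) * blade_sign B (sym_diff A C)"
        by (metis blade_sign_sym_diff_left, metis blade_sign_sym_diff_right)
      then show ?thesis by simp
    qed
    have "cl_coeff (x * y * z) C = (\<Sum>A\<in>UNIV. \<Sum>B\<in>UNIV.
        (blade_sign A (sym_diff A C) * blade_sign B (sym_diff B A)) * cl_coeff x B
          * cl_coeff y (sym_diff B A) * cl_coeff z (sym_diff A C))"
      by (simp add: times_clifford.rep_eq sum_distrib_left sum_distrib_right mult.assoc)
    also have "\<dots> = (\<Sum>B\<in>UNIV. \<Sum>A\<in>UNIV.
        blade_sign B (sym_diff B C) * blade_sign (sym_diff B A) (sym_diff A C) * cl_coeff x B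
          * cl_coeff y (sym_diff B A) * cl_coeff z (sym_diff A C))"
      by (subst sum.swap) (simp only: sign)
    also have "\<dots> = (\<Sum>B\<in>UNIV. \<Sum>D\<in>UNIV.
        blade_sign B (sym_diff B C) * blade_sign D (sym_diff D (sym_diff B C)) * cl_coeff x B
          * cl_coeff y D * cl_coeff z (sym_diff D (sym_diff B C)))"
    proof (rule sum.cong[OF refl])
      fix B :: "'a set"
      have "sym_diff (sym_diff B A) (sym_diff B C) = sym_diff A C" for A
        by auto
      then show "(\<Sum>A\<in>UNIV.
          blade_sign B (sym_diff B C) * blade_sign (sym_diff B A) (sym_diff A C) * cl_coeff x B
            * cl_coeff y (sym_diff B A) * cl_coeff z (sym_diff A C))
        = (\<Sum>D\<in>UNIV.
          blade_sign B (sym_diff B C) * blade_sign D (sym_diff D (sym_diff B C)) * cl_coeff x B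
            * cl_coeff y D * cl_coeff z (sym_diff D (sym_diff B C)))"
        using sum_sym_diff_shift[of "\<lambda>D. blade_sign B (sym_diff B C)
            * blade_sign D (sym_diff D (sym_diff B C)) * cl_coeff x B
            * cl_coeff y D * cl_coeff z (sym_diff D (sym_diff B C))" B]
        by simp
    qed
    also have "\<dots> = cl_coeff (x * (y * z)) C"
      by (simp add: times_clifford.rep_eq sum_distrib_left mult_ac)
    finally show "cl_coeff (x * y * z) C = cl_coeff (x * (y * z)) C" .
  qed
  show "1 * x = x"
  proof (rule clifford_eqI)
    fix C :: "'a set"
    have "cl_coeff (1 * x) C = (\<Sum>A\<in>(UNIV :: 'a set set). if A = {} then cl_coeff x C else 0)"
      unfolding times_clifford.rep_eq one_clifford.rep_eq by (rule sum.cong) auto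
    then show "cl_coeff (1 * x) C = cl_coeff x C" by simp
  qed
  show "x * 1 = x"
  proof (rule clifford_eqI)
    fix C :: "'a set"
    have "sym_diff A C = {} \<longleftrightarrow> A = C" for A by auto
    then have "cl_coeff (x * 1) C = (\<Sum>A\<in>UNIV. if A = C then cl_coeff x C else 0)"
      unfolding times_clifford.rep_eq one_clifford.rep_eq by (intro sum.cong) auto
    then show "cl_coeff (x * 1) C = cl_coeff x C" by simp
  qed
  show "(0::'a clifford) \<noteq> 1"
    by transfer (metis zero_neq_one)
qed (transfer; auto simp: algebra_simps sum.distrib sum_distrib_left)+

end

definition blade :: "'n::{finite,linorder} set \<Rightarrow> 'n clifford" where
  "blade A = Abs_clifford (\<lambda>B. if B = A then 1 else 0)"

abbreviation cl_gen :: "'n::{finite,linorder} \<Rightarrow> 'n clifford" where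
  "cl_gen i \<equiv> blade {i}"

lemma cl_coeff_blade: "cl_coeff (blade A) B = (if B = A then 1 else 0)"
  by (simp add: blade_def Abs_clifford_inverse)

lemma blade_mult: "blade A * blade B = blade_sign A B *\<^sub>R blade (sym_diff A B)"
proof (rule clifford_eqI)
  fix C
  have "sym_diff A C = B \<longleftrightarrow> C = sym_diff A B" by auto
  moreover have "sym_diff A (sym_diff A B) = B" by auto
  moreover have "cl_coeff (blade A * blade B) C
      = (\<Sum>D\<in>UNIV. if D = A then blade_sign A (sym_diff A C) * cl_coeff (blade B) (sym_diff A C) else 0)"
    unfolding times_clifford.rep_eq by (rule sum.cong) (auto simp: cl_coeff_blade)
  ultimately show "cl_coeff (blade A * blade B) C
      = cl_coeff (blade_sign A B *\<^sub>R blade (sym_diff A B)) C"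
    by (simp add: scaleR_clifford.rep_eq cl_coeff_blade)
qed

lemma clifford_relations:
  "cl_gen i * cl_gen j + cl_gen j * cl_gen i = (if i = j then - 2 else 0)"
proof -
  have one: "blade {} = (1 :: 'a clifford)"
    by (rule clifford_eqI) (simp add: cl_coeff_blade one_clifford.rep_eq)
  have sgn: "blade_sign {a} {b} = (if b \<le> a then -1 else 1)" for a b :: 'a
    by (simp add: blade_sign_prod)
  show ?thesis
  proof (cases "i = j")
    case True
    then show ?thesis by (simp add: blade_mult sgn one)
  next
    case False
    moreover have "sym_diff {i} {j} = sym_diff {j} {i}" by auto
    ultimately show ?thesis
      by (cases i j rule: linorder_cases) (auto simp: blade_mult sgn)
  qed
qed

lemma blade_insert_greatest:
  assumes "\<And>a. a \<in> A \<Longrightarrow> a < i"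
  shows "blade (insert i A) = blade A * cl_gen i"
proof -
  have "sym_diff A {i} = insert i A" using assms by auto
  moreover have "{(a, b). a \<in> A \<and> b \<in> {i} \<and> b \<le> a} = {}"
    using assms by fastforce
  then have "blade_sign A {i} = 1" unfolding blade_sign_def by (simp only: card.empty power_0)
  ultimately show ?thesis by (simp add: blade_mult)
qed

lemma clifford_expansion: "x = (\<Sum>A\<in>UNIV. cl_coeff x A *\<^sub>R blade A)"
proof (rule clifford_eqI)
  fix B
  have "cl_coeff (sum f S) B = (\<Sum>A\<in>S. cl_coeff (f A) B)" if "finite S"
    for f :: "'a set \<Rightarrow> 'a clifford" and S
    using that by (induction S) (simp_all add: zero_clifford.rep_eq plus_clifford.rep_eq)
  then show "cl_coeff x B = cl_coeff (\<Sum>A\<in>UNIV. cl_coeff x A *\<^sub>R blade A) B"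
    by (simp add: scaleR_clifford.rep_eq cl_coeff_blade if_distrib cong: if_cong)
qed

text \<open>
  A point \<open>(x\<^sub>0, (x\<^sub>1, \<dots>, x\<^sub>n))\<close> of \<open>\<real>\<^sup>n\<^sup>+\<^sup>1\<close> is represented in \<open>real \<times> (real ^ 'n)\<close>, whose norm is the
  Euclidean one.
\<close>

lemma norm_point_square:
  fixes x :: "real \<times> (real ^ 'n)"
  shows "(norm x)\<^sup>2 = (fst x)\<^sup>2 + (\<Sum>j\<in>UNIV. (snd x $ j)\<^sup>2)"
  by (simp add: norm_prod_def norm_vec_def L2_set_def sum_nonneg)

definition paravector :: "real \<times> (real ^ 'n::{finite,linorder}) \<Rightarrow> 'n::{finite,linorder} clifford" where
  "paravector x = of_real (fst x) + (\<Sum>j\<in>UNIV. (snd x $ j) *\<^sub>R cl_gen j)"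

definition paravector_cnj :: "real \<times> (real ^ 'n::{finite,linorder}) \<Rightarrow> 'n::{finite,linorder} clifford" where
  "paravector_cnj x = of_real (fst x) - (\<Sum>j\<in>UNIV. (snd x $ j) *\<^sub>R cl_gen j)"

text \<open>
  Meant for \<open>1 \<le> l\<close> and \<open>2 * l - 1 \<le> k\<close>; in this range \<open>k + 1 - 2 * l\<close> is \<open>k - 2l + 1\<close> and none of
  the subtractions on \<^typ>\<open>nat\<close> truncates.
\<close>

definition H_poly :: "nat \<Rightarrow> nat \<Rightarrow> real \<times> (real ^ 'n::{finite,linorder}) \<Rightarrow> 'n::{finite,linorder} clifford" where
  "H_poly l k x = (\<Sum>j = 0..k + 1 - 2 * l.
     of_nat ((l + j - 1) choose (l - 1)) * of_nat ((k - l - j) choose (l - 1))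
       * paravector x ^ (k + 1 - 2 * l - j) * paravector_cnj x ^ j)"

text \<open>
  Meant for \<open>\<alpha>, \<beta> > -1\<close>. For \<open>N = 0\<close> and \<open>\<alpha> + \<beta> = -1\<close> the formula involves \<open>\<Gamma>(0)\<close>, which is
  \<open>0\<close> here.
\<close>

definition jacobi_P :: "real \<Rightarrow> real \<Rightarrow> nat \<Rightarrow> real \<Rightarrow> real" where
  "jacobi_P \<alpha> \<beta> N z =
     Gamma (\<alpha> + real N + 1) / (fact N * Gamma (real N + \<alpha> + \<beta> + 1)) *
     (\<Sum>\<nu> = 0..N. real (N choose \<nu>) *
        (Gamma (real N + \<alpha> + \<beta> + real \<nu> + 1) / Gamma (\<alpha> + real \<nu> + 1)) * ((z - 1) / 2) ^ \<nu>)"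

end

theory Submission
  imports Defs
begin

text \<open>
  A paravector \<open>x\<close> and its conjugate have the real sum \<open>2 x\<^sub>0\<close> and the real product \<open>|x|\<^sup>2\<close>. The numbers
  \<open>(l + j - 1) choose (l - 1)\<close> are the coefficients of \<open>(1 - t)\<close> to the power \<open>- l\<close>, so the polynomials
  \<open>H_poly l\<close> have the generating function
  \<open>((1 - x t) (1 - x\<^sup>* t))\<close> to the power \<open>- l\<close>, where \<open>x\<^sup>*\<close> is the conjugate; the base equals
  \<open>1 - (2 x\<^sub>0 t - |x|\<^sup>2 t\<^sup>2)\<close>. Expanding it as a binomial series in \<open>2 x\<^sub>0 t - |x|\<^sup>2 t\<^sup>2\<close> yields the real
  coefficients of a Gegenbauer polynomial. Its terms are matched with those of the Jacobi polynomial
  by means of the values of \<open>\<Gamma>\<close> at half-integers.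
\<close>

section \<open>Powers of the geometric series over a ring that may be noncommutative\<close>

text \<open>One more factor sums the coefficients up to \<open>n\<close>, and the hockey-stick
  identity closes the induction. Only powers of the single element \<open>x\<close> meet, and these
  commute.\<close>

lemma geometric_fps_power_nth:
  fixes x :: "'a::ring_1"
  shows "fps_nth (Abs_fps (\<lambda>n. x ^ n) ^ Suc l) n = of_nat ((l + n) choose l) * x ^ n"
proof (induction l arbitrary: n)
  case (Suc l)
  have "fps_nth (Abs_fps (\<lambda>n. x ^ n) ^ Suc (Suc l)) n
      = (\<Sum>i=0..n. of_nat ((l + i) choose l) * x ^ i * x ^ (n - i))"
    by (subst power_Suc2) (simp only: fps_mult_nth Suc.IH fps_nth_Abs_fps)
  also have "\<dots> = (\<Sum>i=0..n. of_nat ((l + i) choose l) * x ^ n)"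
    by (intro sum.cong refl) (simp add: mult.assoc flip: power_add)
  also have "\<dots> = of_nat (\<Sum>i\<le>n. (l + i) choose l) * x ^ n"
    by (simp add: sum_distrib_right atMost_atLeast0)
  also have "(\<Sum>i\<le>n. (l + i) choose l) = (Suc l + n) choose Suc l"
    by (simp add: choose_rising_sum)
  finally show ?case .
qed simp

lemma geometric_fps_inverse:
  fixes x :: "'a::ring_1"
  shows "(1 - fps_const x * fps_X) * Abs_fps (\<lambda>n. x ^ n) = 1"
proof (rule fps_ext)
  fix n
  show "fps_nth ((1 - fps_const x * fps_X) * Abs_fps (\<lambda>n. x ^ n)) n = fps_nth 1 n"
    by (cases n) (simp_all add: left_diff_distrib mult.assoc)
qed

text \<open>The product \<open>a * b\<close> stands innermost in
  \<open>a ^ Suc l * b ^ Suc l\<close>, so the pairs collapse from the inside even if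
  \<open>a\<close> and \<open>b\<close> do not commute.\<close>

lemma power_mult_power_eq_1:
  fixes a b :: "'a::monoid_mult"
  assumes "a * b = 1"
  shows "a ^ l * b ^ l = 1"
proof (induction l)
  case (Suc l)
  have "a ^ Suc l * b ^ Suc l = a ^ l * (a * b) * b ^ l"
    unfolding power_Suc2[of a] power_Suc[of b] by (simp only: mult.assoc)
  then show ?case by (simp add: assms Suc)
qed simp

section \<open>Generating functions and real power series\<close>

text \<open>Embeds real series as central ones, so that composition of series is done over the
  commutative reals and transferred to the algebra afterwards.\<close>

definition fps_of_real :: "real fps \<Rightarrow> 'a::real_algebra_1 fps" where
  "fps_of_real f = Abs_fps (\<lambda>n. of_real (fps_nth f n))"

lemma fps_of_real_nth [simp]: "fps_nth (fps_of_real f) n = of_real (fps_nth f n)"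
  by (simp add: fps_of_real_def)

lemma fps_of_real_1 [simp]: "fps_of_real 1 = 1"
  by (rule fps_ext) (simp add: fps_one_nth)

lemma fps_of_real_mult: "fps_of_real (f * g) = fps_of_real f * fps_of_real g"
  by (rule fps_ext) (simp add: fps_mult_nth)

lemma fps_of_real_power: "fps_of_real (f ^ l) = fps_of_real f ^ l"
  by (induction l) (simp_all add: fps_of_real_mult)

lemma fps_of_real_commute: "fps_of_real f * g = g * fps_of_real f"
proof (rule fps_ext)
  fix n
  have "fps_nth (fps_of_real f * g) n = (\<Sum>i=0..n. fps_nth g (n - i) * of_real (fps_nth f i))"
    by (simp add: fps_mult_nth of_real_def)
  also have "\<dots> = fps_nth (g * fps_of_real f) n"
    unfolding fps_mult_nth
    by (rule sum.reindex_bij_witness[of _ "\<lambda>i. n - i" "\<lambda>i. n - i"]) auto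
  finally show "fps_nth (fps_of_real f * g) n = fps_nth (g * fps_of_real f) n" .
qed

lemma fps_linear_power_nth:
  fixes s p :: "'a::comm_ring_1"
  shows "fps_nth ((fps_const s - fps_const p * fps_X) ^ i) k
    = of_nat (i choose k) * s ^ (i - k) * (- p) ^ k"
proof -
  have "(fps_const s - fps_const p * fps_X) ^ i
      = (fps_const (- p) * fps_X + fps_const s) ^ i"
    by (simp flip: fps_const_neg)
  also have "\<dots> = (\<Sum>j\<le>i. fps_const (of_nat (i choose j) * (- p) ^ j * s ^ (i - j)) * fps_X ^ j)"
    unfolding binomial_ring
    by (intro sum.cong refl)
      (simp add: power_mult_distrib fps_of_nat[symmetric] mult_ac flip: fps_const_mult fps_const_power)
  finally show ?thesis
    by (cases "k \<le> i")
      (simp_all add: fps_sum_nth mult_delta_right binomial_eq_0)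
qed

text \<open>
  Both sides are the \<open>N\<close>-th coefficient of \<open>(1 - s t + p t\<^sup>2)\<close> to the power \<open>- l - 1\<close>.
\<close>

lemma convolution_eq_gegenbauer:
  fixes x y :: "'a::real_algebra_1"
  assumes sum: "x + y = of_real s" and prod: "x * y = of_real p"
  shows "(\<Sum>j=0..N. of_nat ((l + j) choose l) * of_nat ((l + (N - j)) choose l) * x ^ (N - j) * y ^ j)
    = of_real (\<Sum>i=0..N. real ((l + i) choose l)
        * (real (i choose (N - i)) * s ^ (i - (N - i)) * (- p) ^ (N - i)))"
proof -
  let ?A = "Abs_fps (\<lambda>n. x ^ n)" and ?B = "Abs_fps (\<lambda>n. y ^ n)"
  define P where "P = 1 - fps_const x * fps_X"
  define Q where "Q = 1 - fps_const y * fps_X"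
  \<comment> \<open>Here \<open>u\<close> is \<open>s t - p t\<^sup>2\<close>, without constant
    term, so the geometric series \<open>F\<close> in \<open>u\<close> makes sense and inverts
    \<open>1 - u\<close>.\<close>
  define u where "u = (fps_const s - fps_const p * fps_X) * fps_X"
  define F where "F = Abs_fps (\<lambda>n. 1 :: real) oo u"
  have y: "y = of_real s - x" using sum by (simp add: algebra_simps)
  \<comment> \<open>Being a real number minus \<open>x\<close>, the element \<open>y\<close>
    commutes with \<open>x\<close>.\<close>
  have yx: "y * x = of_real p"
    using prod unfolding y by (simp add: algebra_simps of_real_def)
  have QP: "Q * P = fps_of_real (1 - u)"
  proof (rule fps_ext)
    fix n
    consider "n = 0" | "n = 1" | k where "n = Suc (Suc k)"
      by (metis One_nat_def not0_implies_Suc)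
    then show "fps_nth (Q * P) n = fps_nth (fps_of_real (1 - u)) n"
      using yx y by cases (simp_all add: P_def Q_def u_def left_diff_distrib right_diff_distrib
        mult.assoc fps_one_nth split: nat.splits)
  qed
  have u0: "fps_nth u 0 = 0" by (simp add: u_def)
  have F: "(1 - u) * F = 1"
  proof -
    have "(1 - fps_X) * Abs_fps (\<lambda>n. 1 :: real) = 1"
      using geometric_fps_inverse[of "1 :: real"] by simp
    then have "((1 - fps_X) oo u) * F = 1"
      unfolding F_def by (metis fps_compose_mult_distrib[OF u0] fps_compose_1)
    then show ?thesis by (simp add: fps_compose_sub_distrib u0)
  qed
  have "F ^ Suc l * (1 - u) ^ Suc l = 1"
    using power_mult_power_eq_1[OF F, of "Suc l"] by (simp only: mult.commute)
  then have FU: "fps_of_real (F ^ Suc l) * (fps_of_real (1 - u) :: 'a fps) ^ Suc l = 1"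
    unfolding fps_of_real_power[symmetric] fps_of_real_mult[symmetric] by simp
  \<comment> \<open>The innermost \<open>Q * P\<close> is a real series, hence central, and can be
    pulled out to the front.\<close>
  have U: "fps_of_real (1 - u) ^ k = Q ^ k * P ^ k" for k
  proof (induction k)
    case (Suc k)
    have "Q ^ Suc k * P ^ Suc k = Q ^ k * fps_of_real (1 - u) * P ^ k"
      by (simp only: power_Suc2[of Q] power_Suc[of P] mult.assoc flip: QP)
    also have "\<dots> = fps_of_real (1 - u) * (Q ^ k * P ^ k)"
      by (simp add: mult.assoc fps_of_real_commute)
    finally show ?case by (simp add: Suc)
  qed simp
  have PA: "P ^ Suc l * ?A ^ Suc l = 1" and QB: "Q ^ Suc l * ?B ^ Suc l = 1"
    unfolding P_def Q_def by (intro power_mult_power_eq_1 geometric_fps_inverse)+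
  \<comment> \<open>With \<open>1\<close> inserted in this form, \<open>P ^ Suc l\<close> first
    cancels \<open>?A ^ Suc l\<close> next to it; then \<open>Q ^ Suc l\<close> meets
    \<open>?B ^ Suc l\<close>.\<close>
  have "?A ^ Suc l * ?B ^ Suc l
      = (fps_of_real (F ^ Suc l) * fps_of_real (1 - u) ^ Suc l) * (?A ^ Suc l * ?B ^ Suc l)"
    by (simp only: FU mult_1_left)
  also have "\<dots> = fps_of_real (F ^ Suc l) * (Q ^ Suc l * (P ^ Suc l * ?A ^ Suc l) * ?B ^ Suc l)"
    by (simp only: U mult.assoc)
  also have "\<dots> = fps_of_real (F ^ Suc l)"
    by (simp only: PA QB mult_1_right)
  finally have "?A ^ Suc l * ?B ^ Suc l = fps_of_real (F ^ Suc l)" .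
  then have "fps_nth (?A ^ Suc l * ?B ^ Suc l) N = of_real (fps_nth (F ^ Suc l) N)"
    by simp
  moreover have "fps_nth (?A ^ Suc l * ?B ^ Suc l) N
    = (\<Sum>j=0..N. of_nat ((l + j) choose l) * of_nat ((l + (N - j)) choose l) * x ^ (N - j) * y ^ j)"
  proof -
    have "of_nat d * of_nat c * X * Y = of_nat c * X * (of_nat d * Y)" for c d and X Y :: 'a
      by (metis mult.assoc mult_of_nat_commute)
    then show ?thesis
      unfolding fps_mult_nth geometric_fps_power_nth
      by (intro sum.reindex_bij_witness[of _ "\<lambda>i. N - i" "\<lambda>i. N - i"]) auto
  qed
  moreover have "fps_nth (F ^ Suc l) N = (\<Sum>i=0..N. real ((l + i) choose l)
      * (real (i choose (N - i)) * s ^ (i - (N - i)) * (- p) ^ (N - i)))"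
  proof -
    \<comment> \<open>The factor \<open>t ^ i\<close> of \<open>u ^ i\<close> moves the wanted
      coefficient to index \<open>N - i\<close> of a linear power. Where \<open>i - (N - i)\<close>
      truncates, the binomial coefficient is \<open>0\<close>.\<close>
    have "fps_nth (u ^ i) N = real (i choose (N - i)) * s ^ (i - (N - i)) * (- p) ^ (N - i)"
      if "i \<le> N" for i
      using that unfolding u_def power_mult_distrib mult.commute[of _ "fps_X ^ i"]
      by (simp add: fps_X_power_mult_nth fps_linear_power_nth)
    moreover have "fps_nth (Abs_fps (\<lambda>n. 1 :: real) ^ Suc l) i = real ((l + i) choose l)" for i
      using geometric_fps_power_nth[of "1 :: real" l i] by (simp del: power_Suc)
    ultimately show ?thesis
      unfolding F_def fps_compose_power[OF u0] fps_compose_nth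
      by (intro sum.cong) (simp_all del: power_Suc)
  qed
  ultimately show ?thesis by simp
qed

section \<open>Paravectors and the Gegenbauer form of \<open>H_poly\<close>\<close>

lemma paravector_add_cnj: "paravector x + paravector_cnj x = of_real (2 * fst x)"
  unfolding mult_2 of_real_add by (simp add: paravector_def paravector_cnj_def)

text \<open>Adding the double sum to its transpose produces the anticommutators of the generators,
  of which only the diagonal ones survive.\<close>

lemma vector_part_square:
  fixes v :: "real ^ 'n::{finite,linorder}"
  shows "(\<Sum>j\<in>UNIV. (v $ j) *\<^sub>R cl_gen j) * (\<Sum>j\<in>UNIV. (v $ j) *\<^sub>R cl_gen j)
    = - of_real (\<Sum>j\<in>UNIV. (v $ j)\<^sup>2)" (is "?v * ?v = _")
proof -
  have vv: "?v * ?v = (\<Sum>i\<in>UNIV. \<Sum>j\<in>UNIV. (v $ i * v $ j) *\<^sub>R (cl_gen i * cl_gen j))"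
    by (simp add: sum_product mult.commute)
  then have "2 *\<^sub>R (?v * ?v)
      = (\<Sum>i\<in>UNIV. \<Sum>j\<in>UNIV. (v $ i * v $ j) *\<^sub>R (cl_gen i * cl_gen j + cl_gen j * cl_gen i))"
    unfolding scaleR_2 scaleR_right_distrib sum.distrib
    by (subst (2) vv, subst (2) sum.swap) (simp add: mult.commute)
  also have "\<dots> = (\<Sum>i\<in>UNIV. - 2 *\<^sub>R of_real ((v $ i)\<^sup>2))"
  proof (rule sum.cong[OF refl])
    fix i :: 'n
    have "(v $ i * v $ j) *\<^sub>R (cl_gen i * cl_gen j + cl_gen j * cl_gen i)
        = (if i = j then - 2 *\<^sub>R of_real ((v $ i)\<^sup>2) else 0)" for j
      unfolding clifford_relations by (simp add: power2_eq_square scaleR_conv_of_real mult_2 mult_2_right)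
    then show "(\<Sum>j\<in>UNIV. (v $ i * v $ j) *\<^sub>R (cl_gen i * cl_gen j + cl_gen j * cl_gen i))
        = - 2 *\<^sub>R of_real ((v $ i)\<^sup>2)"
      by simp
  qed
  also have "\<dots> = 2 *\<^sub>R (- of_real (\<Sum>j\<in>UNIV. (v $ j)\<^sup>2))"
    by (simp add: sum_negf scaleR_right.sum)
  finally show ?thesis
    unfolding scaleR_cancel_left by simp
qed

lemma paravector_mult_cnj:
  "paravector x * paravector_cnj x = of_real ((norm x)\<^sup>2)"
  using vector_part_square[of "snd x"]
  unfolding norm_point_square
  by (simp add: paravector_def paravector_cnj_def algebra_simps of_real_def power2_eq_square)

text \<open>The shifted parameters turn the degree \<open>k - 2l + 1\<close> into \<open>N\<close>.
  For \<open>x \<noteq> 0\<close> the real sum is \<open>|x| ^ N\<close> times the Gegenbauer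
  polynomial of degree \<open>N\<close> and parameter \<open>l + 1\<close> at
  \<open>x\<^sub>0 / |x|\<close>.\<close>

lemma H_poly_eq_gegenbauer:
  "H_poly (Suc l) (N + 2 * l + 1) x
    = of_real (\<Sum>i=0..N. real ((l + i) choose l)
        * (real (i choose (N - i)) * (2 * fst x) ^ (i - (N - i)) * (- ((norm x)\<^sup>2)) ^ (N - i)))"
  unfolding convolution_eq_gegenbauer[OF paravector_add_cnj paravector_mult_cnj, symmetric] H_poly_def
proof (intro sum.cong)
  fix j assume "j \<in> {0..N}"
  then have "Suc l + j - 1 = l + j" "Suc l - 1 = l" "N + 2 * l + 1 + 1 - 2 * Suc l - j = N - j"
    "N + 2 * l + 1 - Suc l - j = l + (N - j)"
    by simp_all
  then show "of_nat ((Suc l + j - 1) choose (Suc l - 1))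
      * of_nat ((N + 2 * l + 1 - Suc l - j) choose (Suc l - 1))
      * paravector x ^ (N + 2 * l + 1 + 1 - 2 * Suc l - j) * paravector_cnj x ^ j
    = of_nat ((l + j) choose l) * of_nat ((l + (N - j)) choose l)
      * paravector x ^ (N - j) * paravector_cnj x ^ j"
    by (simp only:)
qed simp

section \<open>Half-integer values of \<open>Gamma\<close> and the coefficient identities\<close>

lemma Gamma_plus_three_halves:
  "Gamma (real n + 3/2) = (real n + 1/2) * Gamma (real n + 1/2)"
proof -
  have "real n + 1/2 \<notin> \<int>\<^sub>\<le>\<^sub>0"
    by (rule notI, drule nonpos_Ints_nonpos) simp
  from Gamma_plus1[OF this] show ?thesis by (simp add: add.assoc)
qed

text \<open>Legendre's duplication formula at \<open>n + 1/2\<close>, cleared of denominators; each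
  induction step contributes \<open>4 (n + 1/2) (n + 1) = (2n + 1) (2n + 2)\<close>.\<close>

lemma Gamma_plus_half:
  "Gamma (real n + 1/2) * (4 ^ n * fact n) = sqrt pi * fact (2 * n)"
proof (induction n)
  case (Suc n)
  have "real (Suc n) + 1/2 = real n + 3/2" by simp
  then have "Gamma (real (Suc n) + 1/2) * (4 ^ Suc n * fact (Suc n))
      = (real n + 1/2) * Gamma (real n + 1/2) * (4 ^ Suc n * fact (Suc n))"
    by (simp only: Gamma_plus_three_halves)
  also have "\<dots> = (2 * real n + 1) * (2 * real n + 2) * (Gamma (real n + 1/2) * (4 ^ n * fact n))"
    by (simp add: algebra_simps)
  also have "\<dots> = sqrt pi * fact (2 * Suc n)"
    unfolding Suc by (simp add: algebra_simps)
  finally show ?case .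
qed (simp add: Gamma_one_half_real)

text \<open>Both sides are \<open>4 ^ i * fact (m + i + l) / (fact l * fact (m - i) * fact (2 *
  i))\<close>. The \<open>4 ^ i\<close> on the left stems from \<open>(2 x\<^sub>0) ^ (2 i)\<close>;
  on the right a prefactor meets a Jacobi coefficient.\<close>

lemma jacobi_coeff_even:
  assumes "i \<le> m"
  shows "real ((l + (m + i)) choose l) * real ((m + i) choose (m - i)) * 4 ^ i
    = sqrt pi * Gamma (real m + real (Suc l)) / (Gamma (real (Suc l)) * Gamma (real m + 1/2))
      * (Gamma (real m + 1/2) / (fact m * Gamma (real m + real (Suc l)))
      * (real (m choose i) * (Gamma (real m + real (Suc l) + real i) / Gamma (real i + 1/2))))"
proof -
  have G: "Gamma (real k + real (Suc l)) = fact (k + l)" for k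
    using Gamma_fact[of "k + l"] by (simp add: add_ac)
  have e1: "Gamma (real i + 1/2) = sqrt pi * fact (2 * i) / (4 ^ i * fact i)"
    using Gamma_plus_half[of i] by (subst nonzero_eq_divide_eq) simp_all
  have e2: "real ((m + i) choose (m - i)) = fact (m + i) / (fact (m - i) * fact (2 * i))"
    using assms by (subst binomial_fact) (auto simp: mult_2)
  have e3: "real ((l + (m + i)) choose l) = fact (m + i + l) / (fact l * fact (m + i))"
    by (subst binomial_fact) (auto simp: add_ac)
  have e4: "real (m choose i) = fact m / (fact i * fact (m - i))"
    using assms by (rule binomial_fact)
  have e5: "Gamma (real (Suc l)) = fact l" "Gamma (real m + real (Suc l)) = fact (m + l)"
    "Gamma (real m + real (Suc l) + real i) = fact (m + i + l)"
    using G[of 0] G[of m] G[of "m + i"] by (simp_all add: add_ac)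
  \<comment> \<open>This value cancels; all that matters is that it is nonzero.\<close>
  define g where "g = Gamma (real m + 1/2)"
  have "g > 0"
    unfolding g_def by (rule Gamma_real_pos) simp
  then show ?thesis
    unfolding e1 e2 e3 e4 e5 g_def[symmetric] by (simp add: divide_simps del: fact_Suc)
qed

text \<open>The common value is now \<open>2 * 4 ^ i * fact (m + i + l + 1) / (fact l * fact (m - i)
  * fact (2 * i + 1))\<close>.\<close>

lemma jacobi_coeff_odd:
  assumes "i \<le> m"
  shows "real ((l + Suc (m + i)) choose l) * real (Suc (m + i) choose (m - i)) * (2 * 4 ^ i)
    = sqrt pi * Gamma (real m + real (Suc l) + 1) / (Gamma (real (Suc l)) * Gamma (real m + 3/2))
      * (Gamma (real m + 3/2) / (fact m * Gamma (real m + real (Suc l) + 1))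
      * (real (m choose i) * (Gamma (real m + real (Suc l) + real i + 1) / Gamma (real i + 3/2))))"
proof -
  have G: "Gamma (real k + real (Suc l) + 1) = fact (k + l + 1)" for k
    using Gamma_fact[of "k + l + 1"] by (simp add: add_ac)
  have e1: "Gamma (real i + 3/2) = sqrt pi * fact (2 * i + 1) / (2 * 4 ^ i * fact i)"
  proof -
    have two: "2 * real i + 1 = 2 * (real i + 1/2)"
      and f: "fact (2 * i + 1) = (2 * real i + 1) * fact (2 * i)"
      by simp_all
    have "Gamma (real i + 3/2) * (2 * 4 ^ i * fact i)
        = (2 * real i + 1) * (Gamma (real i + 1/2) * (4 ^ i * fact i))"
      unfolding Gamma_plus_three_halves two by (simp only: mult_ac)
    also have "\<dots> = sqrt pi * fact (2 * i + 1)"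
      unfolding Gamma_plus_half f by (simp only: mult_ac)
    finally have "sqrt pi * fact (2 * i + 1) = Gamma (real i + 3/2) * (2 * 4 ^ i * fact i)" ..
    then show ?thesis
      by (simp only:) simp
  qed
  have e2: "real (Suc (m + i) choose (m - i)) = fact (m + i + 1) / (fact (m - i) * fact (2 * i + 1))"
  proof -
    have "Suc (m + i) - (m - i) = 2 * i + 1" using assms by simp
    then show ?thesis
      using binomial_fact[of "m - i" "Suc (m + i)", where 'a = real] by (simp del: fact_Suc)
  qed
  have e3: "real ((l + Suc (m + i)) choose l) = fact (m + i + l + 1) / (fact l * fact (m + i + 1))"
    using binomial_fact[of l "l + Suc (m + i)", where 'a = real] by (simp add: add_ac del: fact_Suc)
  have e4: "real (m choose i) = fact m / (fact i * fact (m - i))"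
    using assms by (rule binomial_fact)
  have e0: "Gamma (real (Suc l)) = fact l"
    using Gamma_fact[of l] by (simp add: add_ac)
  have e5: "Gamma (real m + real (Suc l) + 1) = fact (m + l + 1)"
    "Gamma (real m + real (Suc l) + real i + 1) = fact (m + i + l + 1)"
    using G[of m] G[of "m + i"] by (simp_all add: add_ac)
  define g where "g = Gamma (real m + 3/2)"
  have "g > 0"
    unfolding g_def by (rule Gamma_real_pos) simp
  then show ?thesis
    unfolding e0 e1 e2 e3 e4 e5 g_def[symmetric] by (simp add: divide_simps del: fact_Suc)
qed

section \<open>Matching the Gegenbauer sums with Jacobi polynomials\<close>

text \<open>The Jacobi variable \<open>(z - 1) / 2\<close> becomes
  \<open>a\<^sup>2 / (- (r\<^sup>2))\<close>. Splitting \<open>(- (r\<^sup>2)) ^ (m - i)\<close>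
  into a quotient supplies its denominator and leaves the sign and
  \<open>r ^ (2 * m)\<close>.\<close>

lemma jacobi_argument_power:
  fixes a r :: real
  assumes "r \<noteq> 0" "i \<le> m"
  shows "(2 * a) ^ (2 * i) * (- (r\<^sup>2)) ^ (m - i)
    = (- 1) ^ m * r ^ (2 * m) * (4 ^ i * ((1 - 2 * a\<^sup>2 / r\<^sup>2 - 1) / 2) ^ i)"
proof -
  have arg: "(1 - 2 * a\<^sup>2 / r\<^sup>2 - 1) / 2 = a\<^sup>2 / (- (r\<^sup>2))" by simp
  have "(- (r\<^sup>2)) ^ (m - i) = (- (r\<^sup>2)) ^ m / (- (r\<^sup>2)) ^ i"
    using assms by (subst power_diff) auto
  also have "(- (r\<^sup>2)) ^ m = (- 1) ^ m * r ^ (2 * m)"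
    by (simp add: power_mult power_minus[of "r\<^sup>2"])
  finally have r: "(- (r\<^sup>2)) ^ (m - i) = (- 1) ^ m * r ^ (2 * m) / (- (r\<^sup>2)) ^ i" .
  have a: "(2 * a) ^ (2 * i) = 4 ^ i * (a\<^sup>2) ^ i"
    by (simp add: power_mult power_mult_distrib)
  show ?thesis
    unfolding arg r a power_divide by simp
qed

text \<open>Serves both parities of the degree \<open>K + m\<close>: \<open>K = m\<close> for even
  and \<open>K = Suc m\<close> for odd degree. Either way \<open>m + 1\<close> terms remain, as in a
  Jacobi polynomial of degree \<open>m\<close>.\<close>

lemma gegenbauer_sum_shift:
  fixes s q :: real
  assumes "K \<le> Suc m"
  shows "(\<Sum>i=0..K + m. real ((l + i) choose l)
        * (real (i choose (K + m - i)) * s ^ (i - (K + m - i)) * q ^ (K + m - i)))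
    = (\<Sum>i=0..m. real ((l + (K + i)) choose l)
        * (real ((K + i) choose (m - i)) * s ^ (K + i - (m - i)) * q ^ (m - i)))"
    (is "sum ?f _ = sum ?g _")
proof -
  \<comment> \<open>The terms with \<open>i < K\<close> vanish because then \<open>i < K + m - i\<close>.\<close>
  have "sum ?f {0..K + m} = sum ?f {0 + K..m + K}"
    using assms by (intro sum.mono_neutral_right) (auto intro!: binomial_eq_0)
  also have "\<dots> = sum ?g {0..m}"
    unfolding sum.shift_bounds_cl_nat_ivl
    by (simp only: add.commute[of _ K] Nat.diff_cancel)
  finally show ?thesis .
qed

lemma gegenbauer_eq_jacobi_even:
  fixes a r :: real
  assumes "r \<noteq> 0"
  shows "(\<Sum>i=0..m + m. real ((l + i) choose l) * (real (i choose (m + m - i))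
        * (2 * a) ^ (i - (m + m - i)) * (- (r\<^sup>2)) ^ (m + m - i)))
    = (- 1) ^ m * sqrt pi * Gamma (real m + real (Suc l)) * r ^ (2 * m)
        / (Gamma (real (Suc l)) * Gamma (real m + 1 / 2))
        * jacobi_P (- 1 / 2) ((2 * real (Suc l) - 1) / 2) m (1 - 2 * a\<^sup>2 / r\<^sup>2)"
proof -
  define w where "w = (1 - 2 * a\<^sup>2 / r\<^sup>2 - 1) / 2"
  \<comment> \<open>Here \<open>\<alpha> + \<beta>\<close> is \<open>real l\<close>, so every
    \<open>Gamma\<close> argument is positive and the default value at the poles never
    enters.\<close>
  have args: "- 1 / 2 + real m + 1 = real m + 1 / 2" "- 1 / 2 + real i + 1 = real i + 1 / 2"
    "real m + - 1 / 2 + (2 * real (Suc l) - 1) / 2 + 1 = real m + real (Suc l)"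
    "real m + - 1 / 2 + (2 * real (Suc l) - 1) / 2 + real i + 1
      = real m + real (Suc l) + real i" for i
    by (simp_all add: field_simps)
  show ?thesis
    unfolding gegenbauer_sum_shift[OF le_SucI[OF order_refl]]
      jacobi_P_def args w_def[symmetric] sum_distrib_left
  proof (intro sum.cong refl)
    fix i assume "i \<in> {0..m}"
    then have i: "i \<le> m" by simp
    then have e: "m + i - (m - i) = 2 * i" by auto
    have "real ((l + (m + i)) choose l) * (real ((m + i) choose (m - i))
          * (2 * a) ^ (m + i - (m - i)) * (- (r\<^sup>2)) ^ (m - i))
        = real ((l + (m + i)) choose l) * real ((m + i) choose (m - i))
          * ((2 * a) ^ (2 * i) * (- (r\<^sup>2)) ^ (m - i))"
      unfolding e by (simp only: mult.assoc)
    also have "\<dots> = real ((l + (m + i)) choose l) * real ((m + i) choose (m - i)) * 4 ^ i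
        * ((- 1) ^ m * r ^ (2 * m) * w ^ i)"
      unfolding jacobi_argument_power[OF assms i] w_def by (simp only: mult_ac)
    also have "\<dots> = sqrt pi * Gamma (real m + real (Suc l)) / (Gamma (real (Suc l)) * Gamma (real m + 1/2))
        * (Gamma (real m + 1/2) / (fact m * Gamma (real m + real (Suc l)))
        * (real (m choose i) * (Gamma (real m + real (Suc l) + real i) / Gamma (real i + 1/2))))
        * ((- 1) ^ m * r ^ (2 * m) * w ^ i)"
      unfolding jacobi_coeff_even[OF i] ..
    also have "\<dots> = (- 1) ^ m * sqrt pi * Gamma (real m + real (Suc l)) * r ^ (2 * m)
          / (Gamma (real (Suc l)) * Gamma (real m + 1/2))
        * (Gamma (real m + 1/2) / (fact m * Gamma (real m + real (Suc l)))
        * (real (m choose i) * (Gamma (real m + real (Suc l) + real i) / Gamma (real i + 1/2)) * w ^ i))"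
      by (simp only: times_divide_eq_left times_divide_eq_right mult_ac)
    finally show "real ((l + (m + i)) choose l) * (real ((m + i) choose (m - i))
          * (2 * a) ^ (m + i - (m - i)) * (- (r\<^sup>2)) ^ (m - i)) = \<dots>" .
  qed
qed

lemma gegenbauer_eq_jacobi_odd:
  fixes a r :: real
  assumes "r \<noteq> 0"
  shows "(\<Sum>i=0..Suc m + m. real ((l + i) choose l) * (real (i choose (Suc m + m - i))
        * (2 * a) ^ (i - (Suc m + m - i)) * (- (r\<^sup>2)) ^ (Suc m + m - i)))
    = (- 1) ^ m * sqrt pi * Gamma (real m + real (Suc l) + 1) * a * r ^ (2 * m)
        / (Gamma (real (Suc l)) * Gamma (real m + 3 / 2))
        * jacobi_P (1 / 2) ((2 * real (Suc l) - 1) / 2) m (1 - 2 * a\<^sup>2 / r\<^sup>2)"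
proof -
  define w where "w = (1 - 2 * a\<^sup>2 / r\<^sup>2 - 1) / 2"
  have args: "1 / 2 + real m + 1 = real m + 3 / 2" "1 / 2 + real i + 1 = real i + 3 / 2"
    "real m + 1 / 2 + (2 * real (Suc l) - 1) / 2 + 1 = real m + real (Suc l) + 1"
    "real m + 1 / 2 + (2 * real (Suc l) - 1) / 2 + real i + 1
      = real m + real (Suc l) + real i + 1" for i
    by (simp_all add: field_simps)
  show ?thesis
    unfolding gegenbauer_sum_shift[OF order_refl]
      jacobi_P_def args w_def[symmetric] sum_distrib_left
  proof (intro sum.cong refl)
    fix i assume "i \<in> {0..m}"
    then have i: "i \<le> m" by simp
    then have e: "Suc (m + i) - (m - i) = Suc (2 * i)" "Suc m + i = Suc (m + i)" by auto
    \<comment> \<open>The odd exponent leaves an extra \<open>2 * a\<close>: the \<open>2\<close>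
      joins \<open>4 ^ i\<close> in the coefficient identity, and \<open>a\<close> becomes the
      factor \<open>x\<^sub>0\<close> of the prefactor.\<close>
    have "real ((l + (Suc m + i)) choose l) * (real ((Suc m + i) choose (m - i))
          * (2 * a) ^ (Suc m + i - (m - i)) * (- (r\<^sup>2)) ^ (m - i))
        = real ((l + Suc (m + i)) choose l) * real (Suc (m + i) choose (m - i))
          * ((2 * a) * ((2 * a) ^ (2 * i) * (- (r\<^sup>2)) ^ (m - i)))"
      unfolding e power_Suc by (simp only: mult.assoc)
    also have "\<dots> = real ((l + Suc (m + i)) choose l) * real (Suc (m + i) choose (m - i)) * (2 * 4 ^ i)
        * (a * ((- 1) ^ m * r ^ (2 * m) * w ^ i))"
      unfolding jacobi_argument_power[OF assms i] w_def by (simp only: mult_ac)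
    also have "\<dots> = sqrt pi * Gamma (real m + real (Suc l) + 1) / (Gamma (real (Suc l)) * Gamma (real m + 3/2))
        * (Gamma (real m + 3/2) / (fact m * Gamma (real m + real (Suc l) + 1))
        * (real (m choose i) * (Gamma (real m + real (Suc l) + real i + 1) / Gamma (real i + 3/2))))
        * (a * ((- 1) ^ m * r ^ (2 * m) * w ^ i))"
      unfolding jacobi_coeff_odd[OF i] ..
    also have "\<dots> = (- 1) ^ m * sqrt pi * Gamma (real m + real (Suc l) + 1) * a * r ^ (2 * m)
          / (Gamma (real (Suc l)) * Gamma (real m + 3/2))
        * (Gamma (real m + 3/2) / (fact m * Gamma (real m + real (Suc l) + 1))
        * (real (m choose i) * (Gamma (real m + real (Suc l) + real i + 1) / Gamma (real i + 3/2)) * w ^ i))"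
      by (simp only: times_divide_eq_left times_divide_eq_right mult_ac)
    finally show "real ((l + (Suc m + i)) choose l) * (real ((Suc m + i) choose (m - i))
          * (2 * a) ^ (Suc m + i - (m - i)) * (- (r\<^sup>2)) ^ (m - i)) = \<dots>" .
  qed
qed

theorem proposition5p7:
  fixes x :: "real \<times> (real ^ 'n::{finite,linorder})"
    and l m :: nat
  assumes "odd CARD('n)"
    and "1 \<le> l" and "l \<le> (CARD('n) - 1) div 2"
    and "x \<noteq> 0"
  shows "H_poly l (2 * m + 2 * l - 1) x =
           of_real ((- 1) ^ m * sqrt pi * Gamma (real m + real l) * norm x ^ (2 * m)
             / (Gamma (real l) * Gamma (real m + 1 / 2))
             * jacobi_P (- 1 / 2) ((2 * real l - 1) / 2) m (1 - 2 * (fst x)\<^sup>2 / (norm x)\<^sup>2)) \<and>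
         H_poly l (2 * m + 2 * l) x =
           of_real ((- 1) ^ m * sqrt pi * Gamma (real m + real l + 1) * fst x * norm x ^ (2 * m)
             / (Gamma (real l) * Gamma (real m + 3 / 2))
             * jacobi_P (1 / 2) ((2 * real l - 1) / 2) m (1 - 2 * (fst x)\<^sup>2 / (norm x)\<^sup>2))"
proof -
  from \<open>1 \<le> l\<close> obtain L where l: "l = Suc L" by (cases l) auto
  \<comment> \<open>The degrees are thus \<open>m + m\<close> and \<open>Suc m + m\<close>.\<close>
  have N: "2 * m + 2 * l - 1 = m + m + 2 * L + 1" "2 * m + 2 * l = Suc m + m + 2 * L + 1"
    by (simp_all add: l)
  have "norm x \<noteq> 0" using \<open>x \<noteq> 0\<close> by simp
  then show ?thesis
    \<comment> \<open>The second index is a subterm of the first, so the first one has to be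
      rewritten before it.\<close>
    unfolding N(1) unfolding N(2) unfolding l H_poly_eq_gegenbauer
    by (simp only: gegenbauer_eq_jacobi_even gegenbauer_eq_jacobi_odd simp_thms)
qed

end
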